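(* Suppose the source distributions $\mathscr{D}_1,\dots,\mathscr{D}_p$ share a common conditional distribution of the label given the input, that $\mathcal{L}(\mathscr{D}_k,h_k)\le \epsilon$ for all $k\in\{1,\dots,p\}$, and that $$\frac1p\sum_{k=1}^p\sum_{(x,y)\in\mathcal{X}\times\mathcal{Y}}\mathscr{D}_k(y|x)\,\mathscr{U}^1(x)\,L(h_k(x),y)\le M .$$ Then for any $\delta>0$ there exist $\eta>0$ and $z\in\Delta$ such that, for every mixture parameter $\lambda\in\Delta$, $$\mathcal{L}(\mathscr{D}_\lambda,h_z^\eta)\le \epsilon+\delta .$$
   Context: Setting: $\mathcal{X}$ is a nonempty finite set (input space); $\mathcal{Y}\subseteq\mathbb{R}$ is a nonempty convex set (output space); all probability distributions on $\mathcal{X}\times\mathcal{Y}$ and all conditional distributions on $\mathcal{Y}$ are finitely supported, so all sums over $\mathcal{Y}$ are finite sums. $\mathscr{U}^1$ is the uniform distribution on $\mathcal{X}$. $L:\mathcal{Y}\times\mathcal{Y}\to\mathbb{R}_+$ is a loss function that is continuous, and convex in its first argument. For a distribution $\mathscr{D}$ on $\mathcal{X}\times\mathcal{Y}$ and $h:\mathcal{X}\to\mathcal{Y}$, $\mathcal{L}(\mathscr{D},h)=\sum_{(x,y)}\mathscr{D}(x,y)L(h(x),y)$, and $\mathscr{D}^1(x)=\sum_{y}\mathscr{D}(x,y)$ is the marginal on $\mathcal{X}$. There are $p\ge1$ source distributions $\mathscr{D}_1,\dots,\mathscr{D}_p$ on $\mathcal{X}\times\mathcal{Y}$ and predictors $h_k:\mathcal{X}\to\mathcal{Y}$,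 $k\in\{1,\dots,p\}$; $\epsilon>0$ and $M\ge0$ are constants. "Common conditional distribution" means: for every $x\in\mathcal{X}$ there is a probability distribution $\mathscr{D}(\cdot|x)$ on $\mathcal{Y}$, independent of $k$, with $\mathscr{D}_k(x,y)=\mathscr{D}_k^1(x)\mathscr{D}(y|x)$ for all $k,x,y$; one writes $\mathscr{D}_k(y|x)=\mathscr{D}(y|x)$. $\Delta=\{\lambda\in\mathbb{R}^p:\lambda_k\ge0\ \forall k,\ \sum_k\lambda_k=1\}$; for $\lambda\in\Delta$, $\mathscr{D}_\lambda=\sum_{k=1}^p\lambda_k\mathscr{D}_k$. For $z\in\Delta$ and $\eta>0$, the distribution-weighted combination is $$h_z^\eta(x)=\sum_{k=1}^p\frac{z_k\mathscr{D}_k^1(x)+\eta\,\mathscr{U}^1(x)/p}{\sum_{j=1}^pz_j\mathscr{D}_j^1(x)+\eta\,\mathscr{U}^1(x)}\,h_k(x).$$ *)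

theory Defs
  imports "HOL-Probability.Probability"
begin

text \<open>
  The input space is a type of class \<open>finite\<close>; the index set of the \<open>p\<close> sources is a type
  \<open>'p\<close> of class \<open>finite\<close>, so that mixture parameters are vectors in \<open>real ^ 'p\<close> and
  \<open>p = CARD('p) \<ge> 1\<close>. The output space is a set of reals.
\<close>

definition fin_dist_on :: "'a set \<Rightarrow> 'a pmf \<Rightarrow> bool" where
  "fin_dist_on A D \<longleftrightarrow> finite (set_pmf D) \<and> set_pmf D \<subseteq> A"

definition expected_loss ::
  "(real \<Rightarrow> real \<Rightarrow> real) \<Rightarrow> ('x \<times> real) pmf \<Rightarrow> ('x \<Rightarrow> real) \<Rightarrow> real" where
  "expected_loss L D h = (\<Sum>(x, y)\<in>set_pmf D. pmf D (x, y) * L (h x) y)"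

definition marginal :: "('x \<times> real) pmf \<Rightarrow> 'x pmf" where
  "marginal D = map_pmf fst D"

lemma pmf_marginal:
  assumes "finite (set_pmf D)"
  shows "pmf (marginal D) x = (\<Sum>y\<in>snd ` set_pmf D. pmf D (x, y))"
proof -
  have "pmf (marginal D) x = measure (measure_pmf D) (fst -` {x})"
    by (simp add: marginal_def pmf_map)
  also have "\<dots> = measure (measure_pmf D) (fst -` {x} \<inter> set_pmf D)"
    by (rule measure_Int_set_pmf [symmetric])
  also have "\<dots> = sum (pmf D) (fst -` {x} \<inter> set_pmf D)"
    using assms by (simp add: measure_measure_pmf_finite)
  also have "\<dots> = sum (pmf D) (Pair x ` snd ` set_pmf D)"
    using assms by (intro sum.mono_neutral_left) (force simp: set_pmf_iff)+
  also have "\<dots> = (\<Sum>y\<in>snd ` set_pmf D. pmf D (x, y))"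
    by (simp add: sum.reindex inj_on_def)
  finally show ?thesis .
qed

definition prob_simplex :: "(real ^ 'p) set" where
  "prob_simplex = {v. (\<forall>k. 0 \<le> v $ k) \<and> (\<Sum>k\<in>UNIV. v $ k) = 1}"

text \<open>Meaningful only for \<open>v \<in> prob_simplex\<close>; see \<open>pmf_mixture\<close> below.\<close>

definition mixture :: "('p \<Rightarrow> 'a pmf) \<Rightarrow> real ^ 'p \<Rightarrow> 'a pmf" where
  "mixture D v = embed_pmf (\<lambda>a. \<Sum>k\<in>UNIV. v $ k * pmf (D k) a)"

lemma pmf_mixture:
  fixes D :: "'p::finite \<Rightarrow> 'a pmf"
  assumes "v \<in> prob_simplex"
  shows "pmf (mixture D v) a = (\<Sum>k\<in>UNIV. v $ k * pmf (D k) a)"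
  unfolding mixture_def
proof (rule pmf_embed_pmf)
  have nn: "0 \<le> v $ k" for k
    using assms by (simp add: prob_simplex_def)
  show "0 \<le> (\<Sum>k\<in>UNIV. v $ k * pmf (D k) a)" for a
    by (intro sum_nonneg mult_nonneg_nonneg nn pmf_nonneg)
  have "(\<integral>\<^sup>+a. ennreal (\<Sum>k\<in>UNIV. v $ k * pmf (D k) a) \<partial>count_space UNIV)
      = (\<integral>\<^sup>+a. (\<Sum>k\<in>UNIV. ennreal (v $ k) * ennreal (pmf (D k) a)) \<partial>count_space UNIV)"
    by (simp add: nn sum_ennreal [symmetric] ennreal_mult)
  also have "\<dots> = (\<Sum>k\<in>UNIV. ennreal (v $ k))"
    by (simp add: nn_integral_sum nn_integral_cmult nn_integral_pmf_eq_1)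
  also have "\<dots> = 1"
    using assms by (simp add: nn sum_ennreal prob_simplex_def)
  finally show "(\<integral>\<^sup>+a. ennreal (\<Sum>k\<in>UNIV. v $ k * pmf (D k) a) \<partial>count_space UNIV) = 1" .
qed

definition uniform_dist :: "'x::finite pmf" where
  "uniform_dist = pmf_of_set UNIV"

definition dist_weighted ::
  "('p::finite \<Rightarrow> ('x::finite \<times> real) pmf) \<Rightarrow> ('p \<Rightarrow> 'x \<Rightarrow> real) \<Rightarrow> real ^ 'p \<Rightarrow> real
    \<Rightarrow> 'x \<Rightarrow> real" where
  "dist_weighted D h z \<eta> x =
    (\<Sum>k\<in>UNIV.
      (z $ k * pmf (marginal (D k)) x + \<eta> * pmf uniform_dist x / real CARD('p))
      / ((\<Sum>j\<in>UNIV. z $ j * pmf (marginal (D j)) x) + \<eta> * pmf uniform_dist x)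
      * h k x)"

text \<open>
  \<open>C\<close> is a conditional distribution of the label given the input shared by all \<open>D k\<close>.
  At inputs \<open>x\<close> that are null for every source, \<open>C x\<close> is an arbitrary distribution on \<open>Y\<close>.
\<close>

definition common_conditional ::
  "real set \<Rightarrow> ('p \<Rightarrow> ('x \<times> real) pmf) \<Rightarrow> ('x \<Rightarrow> real pmf) \<Rightarrow> bool" where
  "common_conditional Y D C \<longleftrightarrow>
    (\<forall>x. fin_dist_on Y (C x)) \<and>
    (\<forall>k x y. pmf (D k) (x, y) = pmf (marginal (D k)) x * pmf (C x) y)"

end

theory Submission
  imports Defs
begin

text \<open>
  Brouwer's theorem applied to a smoothed reweighting of the simplex by the source losses of
  \<open>h\<^sub>z\<close> gives a \<open>z\<close> for which no source loss exceeds the loss on the mixture \<open>D\<^sub>z\<close> itself by more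
  than an arbitrarily small amount. On \<open>D\<^sub>z\<close>, the denominator in \<open>h\<^sub>z\<close> is, up to the smoothing
  term, the input density, so convexity of the loss bounds the loss by
  \<open>(\<Sum>k. z\<^sub>k * \<L>(D\<^sub>k, h\<^sub>k)) + \<eta> * M \<le> \<epsilon> + \<eta> * M\<close>. The loss is linear in the distribution, so a
  bound for all sources is a bound for all mixtures.
\<close>

section \<open>The probability simplex and balanced weights on it\<close>

lemma compact_prob_simplex: "compact (prob_simplex :: (real ^ 'p::finite) set)"
proof -
  have "norm v \<le> 1" if "v \<in> prob_simplex" for v :: "real ^ 'p"
    using norm_le_l1_cart[of v] that by (simp add: prob_simplex_def)
  then have "bounded (prob_simplex :: (real ^ 'p) set)"
    by (auto simp: bounded_iff)
  moreover have "closed (prob_simplex :: (real ^ 'p) set)"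
    unfolding prob_simplex_def
    by (intro closed_Collect_conj closed_Collect_all closed_Collect_le closed_Collect_eq
        continuous_intros)
  ultimately show ?thesis
    by (simp add: compact_eq_bounded_closed)
qed

lemma convex_prob_simplex: "convex (prob_simplex :: (real ^ 'p::finite) set)"
  by (auto intro!: convexI simp: prob_simplex_def sum.distrib simp flip: sum_distrib_left)

lemma prob_simplex_nonempty: "(prob_simplex :: (real ^ 'p::finite) set) \<noteq> {}"
proof -
  have "(\<chi> k. 1 / real CARD('p)) \<in> (prob_simplex :: (real ^ 'p) set)"
    by (simp add: prob_simplex_def)
  then show ?thesis
    by blast
qed

text \<open>At a fixed point of the map \<open>\<phi>\<close> below,
  \<open>z $ k * (S z - F z k)\<close> equals \<open>r / real CARD('p)\<close>, which is positive,
  so \<open>F z k\<close> cannot exceed \<open>S z\<close>. Adding \<open>r\<close> also keeps the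
  normalizer \<open>S z\<close> positive where all the values of \<open>F\<close> vanish.\<close>

lemma exists_balanced_weights:
  fixes F :: "real ^ 'p::finite \<Rightarrow> 'p \<Rightarrow> real"
  assumes cont: "\<And>k. continuous_on prob_simplex (\<lambda>z. F z k)"
    and nonneg: "\<And>z k. z \<in> prob_simplex \<Longrightarrow> 0 \<le> F z k"
    and "r > 0"
  obtains z where "z \<in> prob_simplex" "\<And>k. F z k \<le> (\<Sum>j\<in>UNIV. z $ j * F z j) + r"
proof -
  define S where "S z = (\<Sum>j\<in>UNIV. z $ j * F z j) + r" for z
  define \<phi> where "\<phi> z = (\<chi> k. (z $ k * F z k + r / real CARD('p)) / S z)" for z :: "real ^ 'p"
  have S_pos: "S z > 0" if "z \<in> prob_simplex" for z
  proof -
    have "0 \<le> (\<Sum>j\<in>UNIV. z $ j * F z j)"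
      using that nonneg[OF that] by (intro sum_nonneg) (simp add: prob_simplex_def)
    then show ?thesis
      using \<open>r > 0\<close> by (simp add: S_def)
  qed
  have "continuous_on prob_simplex S"
    unfolding S_def by (intro continuous_intros cont)
  then have "continuous_on prob_simplex \<phi>"
    unfolding \<phi>_def using S_pos
    by (intro continuous_intros cont) (auto simp: less_imp_neq[THEN not_sym])
  moreover have "\<phi> \<in> prob_simplex \<rightarrow> prob_simplex"
  proof
    fix z :: "real ^ 'p"
    assume z: "z \<in> prob_simplex"
    have "(\<Sum>k\<in>UNIV. \<phi> z $ k) = (\<Sum>k\<in>UNIV. z $ k * F z k + r / real CARD('p)) / S z"
      by (simp add: \<phi>_def sum_divide_distrib)
    also have "\<dots> = 1"
      using S_pos[OF z] by (simp add: S_def sum.distrib)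
    finally show "\<phi> z \<in> prob_simplex"
      using z nonneg[OF z] S_pos[OF z] \<open>r > 0\<close> by (simp add: prob_simplex_def \<phi>_def)
  qed
  ultimately obtain z where z: "z \<in> prob_simplex" and fix_z: "\<phi> z = z"
    using brouwer[OF compact_prob_simplex convex_prob_simplex prob_simplex_nonempty] by metis
  have "F z k \<le> S z" for k
  proof -
    have "z $ k = (z $ k * F z k + r / real CARD('p)) / S z"
      using arg_cong[OF fix_z, of "\<lambda>v. v $ k"] by (simp add: \<phi>_def)
    then have eq: "z $ k * S z = z $ k * F z k + r / real CARD('p)"
      using S_pos[OF z] by (simp add: field_simps)
    moreover have "r / real CARD('p) > 0"
      using \<open>r > 0\<close> by simp
    \<comment> \<open>Strictness comes from the smoothing term; it rules out
      \<open>z $ k = 0\<close>, so the factor can be cancelled for every \<open>k\<close>.\<close>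
    ultimately have "z $ k * F z k < z $ k * S z"
      by linarith
    moreover have "z $ k \<ge> 0"
      using z by (simp add: prob_simplex_def)
    ultimately show ?thesis
      by (meson less_imp_le mult_less_cancel_left not_le)
  qed
  then show ?thesis
    using that z by (simp add: S_def)
qed

section \<open>Expected losses as sums over a common finite set\<close>

lemma expected_loss_superset:
  assumes "finite T" "set_pmf D \<subseteq> T"
  shows "expected_loss L D f = (\<Sum>(x, y)\<in>T. pmf D (x, y) * L (f x) y)"
  unfolding expected_loss_def using assms
  by (intro sum.mono_neutral_left) (auto simp: set_pmf_iff)

lemma expected_loss_mixture:
  fixes D :: "'p::finite \<Rightarrow> ('x \<times> real) pmf"
  assumes fin: "\<And>k. finite (set_pmf (D k))" and v: "v \<in> prob_simplex"
  shows "expected_loss L (mixture D v) f = (\<Sum>k\<in>UNIV. v $ k * expected_loss L (D k) f)"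
proof -
  define T where "T = (\<Union>k. set_pmf (D k))"
  have T: "finite T"
    using fin by (simp add: T_def)
  \<comment> \<open>Only an inclusion is available: a source of weight zero need not contribute its
    support.\<close>
  have "set_pmf (mixture D v) \<subseteq> T"
  proof
    fix a
    assume "a \<in> set_pmf (mixture D v)"
    then have "(\<Sum>k\<in>UNIV. v $ k * pmf (D k) a) \<noteq> 0"
      by (simp add: set_pmf_iff pmf_mixture[OF v])
    then obtain k where "v $ k * pmf (D k) a \<noteq> 0"
      by (meson sum.not_neutral_contains_not_neutral)
    then show "a \<in> T"
      by (auto simp: T_def set_pmf_iff)
  qed
  then have "expected_loss L (mixture D v) f
      = (\<Sum>(x, y)\<in>T. (\<Sum>k\<in>UNIV. v $ k * pmf (D k) (x, y)) * L (f x) y)"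
    using T by (simp add: expected_loss_superset pmf_mixture[OF v])
  also have "\<dots> = (\<Sum>k\<in>UNIV. \<Sum>(x, y)\<in>T. v $ k * (pmf (D k) (x, y) * L (f x) y))"
    by (subst sum.swap) (simp add: case_prod_unfold sum_distrib_right mult.assoc)
  also have "\<dots> = (\<Sum>k\<in>UNIV. v $ k * (\<Sum>(x, y)\<in>T. pmf (D k) (x, y) * L (f x) y))"
    by (simp add: sum_distrib_left case_prod_unfold)
  also have "\<dots> = (\<Sum>k\<in>UNIV. v $ k * expected_loss L (D k) f)"
  proof -
    have "set_pmf (D k) \<subseteq> T" for k
      by (auto simp: T_def)
    then show ?thesis
      using T by (simp add: expected_loss_superset)
  qed
  finally show ?thesis .
qed

lemma expected_loss_nonneg:
  assumes "fin_dist_on (UNIV \<times> Y) D" "\<And>x. f x \<in> Y"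
    and "\<And>a y. a \<in> Y \<Longrightarrow> y \<in> Y \<Longrightarrow> 0 \<le> L a y"
  shows "0 \<le> expected_loss L D f"
  unfolding expected_loss_def using assms
  by (intro sum_nonneg) (auto simp: fin_dist_on_def)

text \<open>Neither the index set nor \<open>C\<close> depends on \<open>k\<close>, so the sources
  differ only in their marginals and their losses can be added termwise. Inputs that are null for a
  source contribute zero, whatever \<open>C\<close> is there.\<close>

lemma expected_loss_common_conditional:
  fixes D :: "'p \<Rightarrow> ('x::finite \<times> real) pmf"
  assumes "common_conditional Y D C"
  shows "expected_loss L (D k) f = (\<Sum>(x, y)\<in>(SIGMA x:UNIV. set_pmf (C x)).
    pmf (marginal (D k)) x * pmf (C x) y * L (f x) y)"
proof -
  have eq: "pmf (D k) (x, y) = pmf (marginal (D k)) x * pmf (C x) y" for x y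
    using assms by (simp add: common_conditional_def)
  have "set_pmf (D k) \<subseteq> (SIGMA x:UNIV. set_pmf (C x))"
    by (auto simp: set_pmf_iff eq)
  moreover have "finite (SIGMA x:UNIV. set_pmf (C x))"
    using assms by (intro finite_SigmaI) (auto simp: common_conditional_def fin_dist_on_def)
  ultimately show ?thesis
    by (simp add: expected_loss_superset eq)
qed

section \<open>The distribution-weighted combination as a convex combination\<close>

definition combination_weight ::
  "('p::finite \<Rightarrow> ('x::finite \<times> real) pmf) \<Rightarrow> real ^ 'p \<Rightarrow> real \<Rightarrow> 'x \<Rightarrow> 'p \<Rightarrow> real" where
  "combination_weight D z \<eta> x k =
    z $ k * pmf (marginal (D k)) x + \<eta> * pmf uniform_dist x / real CARD('p)"

text \<open>The common denominator of the coefficients in \<open>dist_weighted\<close>, whose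
  numerators are the values of \<open>combination_weight\<close>.\<close>

definition combination_mass ::
  "('p::finite \<Rightarrow> ('x::finite \<times> real) pmf) \<Rightarrow> real ^ 'p \<Rightarrow> real \<Rightarrow> 'x \<Rightarrow> real" where
  "combination_mass D z \<eta> x =
    (\<Sum>j\<in>UNIV. z $ j * pmf (marginal (D j)) x) + \<eta> * pmf uniform_dist x"

text \<open>Scalar multiplication by \<open>*\<^sub>R\<close> is the form in which
  \<open>convex_sum\<close> and \<open>convex_on_sum\<close> apply.\<close>

lemma dist_weighted_alt:
  "dist_weighted D h z \<eta> x =
    (\<Sum>k\<in>UNIV. (combination_weight D z \<eta> x k / combination_mass D z \<eta> x) *\<^sub>R h k x)"
  by (simp add: dist_weighted_def combination_weight_def combination_mass_def)

lemma sum_combination_weight: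
  "(\<Sum>k\<in>UNIV. combination_weight D z \<eta> x k) = combination_mass D z \<eta> x"
  by (simp add: combination_weight_def combination_mass_def sum.distrib)

context
  fixes D :: "'p::finite \<Rightarrow> ('x::finite \<times> real) pmf" and z :: "real ^ 'p" and \<eta> :: real
  assumes z: "z \<in> prob_simplex" and \<eta>: "\<eta> > 0"
begin

lemma combination_weight_nonneg: "0 \<le> combination_weight D z \<eta> x k"
  using z \<eta> by (simp add: combination_weight_def prob_simplex_def)

text \<open>The uniform distribution charges every input, so the smoothing keeps the denominator
  away from zero even at inputs that no source charges.\<close>

lemma combination_mass_pos: "0 < combination_mass D z \<eta> x"
proof -
  have "0 \<le> (\<Sum>j\<in>UNIV. z $ j * pmf (marginal (D j)) x)"
    using z by (intro sum_nonneg) (simp add: prob_simplex_def)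
  moreover have "0 < \<eta> * pmf (uniform_dist :: 'x pmf) x"
    using \<eta> by (simp add: uniform_dist_def)
  ultimately show ?thesis
    unfolding combination_mass_def by linarith
qed

lemma normalized_combination_weight:
  "(\<Sum>k\<in>UNIV. combination_weight D z \<eta> x k / combination_mass D z \<eta> x) = 1"
  using combination_mass_pos[of x]
  by (simp add: sum_combination_weight flip: sum_divide_distrib)

lemma dist_weighted_in_convex:
  assumes "convex Y" "\<And>k. h k x \<in> Y"
  shows "dist_weighted D h z \<eta> x \<in> Y"
  unfolding dist_weighted_alt
  using assms combination_weight_nonneg[of x] combination_mass_pos[of x]
    normalized_combination_weight[of x]
  by (intro convex_sum) (auto simp: less_imp_le)

text \<open>Jensen's inequality, multiplied through by the denominator.\<close>

lemma convex_on_dist_weighted: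
  assumes "convex_on Y g" "\<And>k. h k x \<in> Y"
  shows "combination_mass D z \<eta> x * g (dist_weighted D h z \<eta> x)
    \<le> (\<Sum>k\<in>UNIV. combination_weight D z \<eta> x k * g (h k x))"
proof -
  have "g (dist_weighted D h z \<eta> x)
      \<le> (\<Sum>k\<in>UNIV. combination_weight D z \<eta> x k / combination_mass D z \<eta> x * g (h k x))"
    unfolding dist_weighted_alt
    using assms combination_weight_nonneg[of x] combination_mass_pos[of x]
      normalized_combination_weight[of x]
    by (intro convex_on_sum) (auto simp: less_imp_le)
  also have "\<dots> = (\<Sum>k\<in>UNIV. combination_weight D z \<eta> x k * g (h k x))
      / combination_mass D z \<eta> x"
    by (simp add: sum_divide_distrib)
  finally show ?thesis
    using combination_mass_pos[of x] by (simp add: field_simps)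
qed

text \<open>Under the \<open>z\<close>-mixture, the density of an input is at most
  \<open>combination_mass\<close>, which is what Jensen's inequality needs as a factor. Of the
  resulting weights, the part from \<open>z\<close> gives the losses of the \<open>h k\<close> on
  their own sources, and the uniform part gives the term with \<open>\<eta>\<close>.\<close>

lemma expected_loss_own_mixture_le:
  assumes L_nonneg: "\<And>a y. a \<in> Y \<Longrightarrow> y \<in> Y \<Longrightarrow> 0 \<le> L a y"
    and L_convex: "\<And>y. y \<in> Y \<Longrightarrow> convex_on Y (\<lambda>a. L a y)"
    and "convex Y"
    and h: "\<And>k x. h k x \<in> Y"
    and C: "common_conditional Y D C"
  shows "(\<Sum>k\<in>UNIV. z $ k * expected_loss L (D k) (dist_weighted D h z \<eta>))
    \<le> (\<Sum>k\<in>UNIV. z $ k * expected_loss L (D k) (h k))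
      + \<eta> * (1 / real CARD('p) *
          (\<Sum>k\<in>UNIV. \<Sum>(x, y)\<in>(SIGMA x:UNIV. set_pmf (C x)).
            pmf (C x) y * pmf uniform_dist x * L (h k x) y))"
proof -
  define T where "T = (SIGMA x:UNIV. set_pmf (C x))"
  define f where "f = dist_weighted D h z \<eta>"
  define w where "w = combination_weight D z \<eta>"
  have f: "f x \<in> Y" for x
    unfolding f_def using \<open>convex Y\<close> h by (rule dist_weighted_in_convex)
  have T: "y \<in> Y" if "(x, y) \<in> T" for x y
    using C that by (auto simp: T_def common_conditional_def fin_dist_on_def)
  note loss = expected_loss_common_conditional[OF C, of L, folded T_def]
  have "(\<Sum>k\<in>UNIV. z $ k * expected_loss L (D k) f)
      = (\<Sum>k\<in>UNIV. \<Sum>(x, y)\<in>T. z $ k * pmf (marginal (D k)) x * (pmf (C x) y * L (f x) y))"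
    by (simp add: loss sum_distrib_left case_prod_unfold mult.assoc)
  also have "\<dots> = (\<Sum>(x, y)\<in>T. (\<Sum>k\<in>UNIV. z $ k * pmf (marginal (D k)) x)
      * (pmf (C x) y * L (f x) y))"
    by (subst sum.swap) (simp add: sum_distrib_right case_prod_unfold)
  also have "\<dots> \<le> (\<Sum>(x, y)\<in>T. pmf (C x) y * (\<Sum>k\<in>UNIV. w x k * L (h k x) y))"
  proof (intro sum_mono, clarify)
    fix x y
    assume "(x, y) \<in> T"
    then have y: "y \<in> Y"
      by (rule T)
    \<comment> \<open>The two sides differ by the smoothing term; enlarging the factor is harmless
      because the loss is nonnegative.\<close>
    have "(\<Sum>k\<in>UNIV. z $ k * pmf (marginal (D k)) x) \<le> combination_mass D z \<eta> x"
      using \<eta> by (simp add: combination_mass_def)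
    then have "(\<Sum>k\<in>UNIV. z $ k * pmf (marginal (D k)) x) * L (f x) y
        \<le> combination_mass D z \<eta> x * L (f x) y"
      by (rule mult_right_mono) (rule L_nonneg[OF f y])
    also have "\<dots> \<le> (\<Sum>k\<in>UNIV. w x k * L (h k x) y)"
      unfolding f_def w_def using L_convex[OF y] h by (rule convex_on_dist_weighted)
    finally have "pmf (C x) y * ((\<Sum>k\<in>UNIV. z $ k * pmf (marginal (D k)) x) * L (f x) y)
        \<le> pmf (C x) y * (\<Sum>k\<in>UNIV. w x k * L (h k x) y)"
      by (rule mult_left_mono) simp
    then show "(\<Sum>k\<in>UNIV. z $ k * pmf (marginal (D k)) x) * (pmf (C x) y * L (f x) y)
        \<le> pmf (C x) y * (\<Sum>k\<in>UNIV. w x k * L (h k x) y)"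
      by (simp add: mult.left_commute)
  qed
  \<comment> \<open>Each weight is split into its source part and its uniform part.\<close>
  also have "\<dots> = (\<Sum>k\<in>UNIV. \<Sum>(x, y)\<in>T.
      z $ k * (pmf (marginal (D k)) x * pmf (C x) y * L (h k x) y)
      + \<eta> * (1 / real CARD('p) * (pmf (C x) y * pmf uniform_dist x * L (h k x) y)))"
    by (subst sum.swap)
      (simp add: w_def combination_weight_def sum_distrib_left case_prod_unfold algebra_simps)
  also have "\<dots> = (\<Sum>k\<in>UNIV. z $ k * expected_loss L (D k) (h k))
      + \<eta> * (1 / real CARD('p) *
          (\<Sum>k\<in>UNIV. \<Sum>(x, y)\<in>T. pmf (C x) y * pmf uniform_dist x * L (h k x) y))"
    unfolding loss case_prod_unfold sum.distrib sum_distrib_left ..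
  finally show ?thesis
    by (simp only: f_def T_def)
qed

end

text \<open>With \<open>E\<close> fixed, the loss is a finite sum in which \<open>z\<close> enters
  only through coefficients with nonvanishing denominators. Continuity of \<open>L\<close> is given
  on \<open>Y \<times> Y\<close> only, so convexity of \<open>Y\<close> is used to keep the
  combination inside \<open>Y\<close>.\<close>

lemma continuous_on_expected_loss_dist_weighted:
  fixes D :: "'p::finite \<Rightarrow> ('x::finite \<times> real) pmf"
  assumes L_cont: "continuous_on (Y \<times> Y) (\<lambda>(a, y). L a y)"
    and "convex Y" and h: "\<And>k x. h k x \<in> Y"
    and E: "fin_dist_on (UNIV \<times> Y) E" and "\<eta> > 0"
  shows "continuous_on prob_simplex (\<lambda>z. expected_loss L E (dist_weighted D h z \<eta>))"
proof -
  have f_cont: "continuous_on prob_simplex (\<lambda>z. dist_weighted D h z \<eta> x)" for x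
  proof -
    have "combination_mass D z \<eta> x \<noteq> 0" if "z \<in> prob_simplex" for z
      using combination_mass_pos[OF that \<open>\<eta> > 0\<close>, of D x] by simp
    then show ?thesis
      unfolding dist_weighted_def combination_mass_def by (intro continuous_intros) auto
  qed
  have "continuous_on prob_simplex (\<lambda>z. L (dist_weighted D h z \<eta> x) y)" if "y \<in> Y" for x y
  proof -
    have "continuous_on prob_simplex (\<lambda>z. case (dist_weighted D h z \<eta> x, y) of (a, y) \<Rightarrow> L a y)"
      using dist_weighted_in_convex[OF _ \<open>\<eta> > 0\<close> \<open>convex Y\<close> h] that
      by (intro continuous_on_compose2[OF L_cont] continuous_on_Pair f_cont continuous_on_const)
        auto
    then show ?thesis
      by simp
  qed
  then show ?thesis
    unfolding expected_loss_def case_prod_unfold using E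
    by (intro continuous_on_sum continuous_on_mult continuous_on_const)
      (auto simp: fin_dist_on_def)
qed

section \<open>Choice of the parameters and passage to all mixtures\<close>

theorem theorem3:
  fixes Y :: "real set"
    and L :: "real \<Rightarrow> real \<Rightarrow> real"
    and D :: "'p::finite \<Rightarrow> ('x::finite \<times> real) pmf"
    and C :: "'x \<Rightarrow> real pmf"
    and h :: "'p \<Rightarrow> 'x \<Rightarrow> real"
    and \<epsilon> M \<delta> :: real
  assumes "Y \<noteq> {}" and "convex Y"
    and "\<And>a y. a \<in> Y \<Longrightarrow> y \<in> Y \<Longrightarrow> 0 \<le> L a y"
    and "continuous_on (Y \<times> Y) (\<lambda>(a, y). L a y)"
    and "\<And>y. y \<in> Y \<Longrightarrow> convex_on Y (\<lambda>a. L a y)"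
    and "\<And>k. fin_dist_on (UNIV \<times> Y) (D k)"
    and "\<And>k x. h k x \<in> Y"
    and "\<epsilon> > 0" and "M \<ge> 0"
    and "common_conditional Y D C"
    and "\<And>k. expected_loss L (D k) (h k) \<le> \<epsilon>"
    and "1 / real CARD('p) *
          (\<Sum>k\<in>UNIV. \<Sum>(x, y)\<in>(SIGMA x:UNIV. set_pmf (C x)).
            pmf (C x) y * pmf uniform_dist x * L (h k x) y) \<le> M"
    and "\<delta> > 0"
  shows "\<exists>\<eta>>0. \<exists>z\<in>prob_simplex. \<forall>v\<in>prob_simplex.
    expected_loss L (mixture D v) (dist_weighted D h z \<eta>) \<le> \<epsilon> + \<delta>"
proof -
  note Y = \<open>convex Y\<close> and L_nonneg = assms(3) and dist = assms(6) and h = assms(7)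
  \<comment> \<open>Chosen so that \<open>\<eta> * M\<close> uses at most half of
    \<open>\<delta>\<close>; \<open>M + 1\<close> in place of \<open>M\<close> covers
    \<open>M = 0\<close>.\<close>
  define \<eta> where "\<eta> = \<delta> / (2 * (M + 1))"
  have \<eta>: "\<eta> > 0"
    using \<open>\<delta> > 0\<close> \<open>M \<ge> 0\<close> by (simp add: \<eta>_def)
  have "\<eta> * M \<le> \<eta> * (M + 1)"
    using \<eta> by simp
  also have "\<dots> = \<delta> / 2"
    using \<open>M \<ge> 0\<close> by (simp add: \<eta>_def divide_simps)
  finally have \<eta>M: "\<eta> * M \<le> \<delta> / 2" .
  \<comment> \<open>The other half of \<open>\<delta>\<close> is the slack in the balancing. Since
    \<open>\<eta>\<close> is already fixed, the losses are continuous functions of \<open>z\<close>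
    alone.\<close>
  obtain z where z: "z \<in> prob_simplex"
    and bal: "\<And>k. expected_loss L (D k) (dist_weighted D h z \<eta>)
      \<le> (\<Sum>j\<in>UNIV. z $ j * expected_loss L (D j) (dist_weighted D h z \<eta>)) + \<delta> / 2"
  proof (rule exists_balanced_weights
      [where F = "\<lambda>z k. expected_loss L (D k) (dist_weighted D h z \<eta>)"])
    show "continuous_on prob_simplex (\<lambda>z. expected_loss L (D k) (dist_weighted D h z \<eta>))" for k
      using assms(4) Y h dist \<eta> by (rule continuous_on_expected_loss_dist_weighted)
    show "0 \<le> expected_loss L (D k) (dist_weighted D h z \<eta>)" if "z \<in> prob_simplex" for z k
      using dist dist_weighted_in_convex[OF that \<eta> Y h] L_nonneg by (rule expected_loss_nonneg)
    show "\<delta> / 2 > 0"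
      using \<open>\<delta> > 0\<close> by simp
  qed (rule that)
  \<comment> \<open>Needed twice: with weights \<open>z\<close> for the losses of the
    \<open>h k\<close> on their own sources, and with weights \<open>v\<close> for the final bound
    on an arbitrary mixture.\<close>
  have average_le: "(\<Sum>k\<in>UNIV. v $ k * g k) \<le> b"
    if "v \<in> prob_simplex" "\<And>k. g k \<le> b" for v :: "real ^ 'p" and g b
  proof -
    have "(\<Sum>k\<in>UNIV. v $ k * g k) \<le> (\<Sum>k\<in>UNIV. v $ k * b)"
      using that by (intro sum_mono mult_left_mono) (auto simp: prob_simplex_def)
    then show ?thesis
      using that(1) by (simp add: prob_simplex_def flip: sum_distrib_right)
  qed
  have "(\<Sum>k\<in>UNIV. z $ k * expected_loss L (D k) (dist_weighted D h z \<eta>))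
    \<le> (\<Sum>k\<in>UNIV. z $ k * expected_loss L (D k) (h k))
      + \<eta> * (1 / real CARD('p) *
          (\<Sum>k\<in>UNIV. \<Sum>(x, y)\<in>(SIGMA x:UNIV. set_pmf (C x)).
            pmf (C x) y * pmf uniform_dist x * L (h k x) y))"
    using z \<eta> L_nonneg assms(5) Y h assms(10) by (rule expected_loss_own_mixture_le)
  moreover have "(\<Sum>k\<in>UNIV. z $ k * expected_loss L (D k) (h k)) \<le> \<epsilon>"
    using z assms(11) by (rule average_le)
  moreover have "\<eta> * (1 / real CARD('p) *
          (\<Sum>k\<in>UNIV. \<Sum>(x, y)\<in>(SIGMA x:UNIV. set_pmf (C x)).
            pmf (C x) y * pmf uniform_dist x * L (h k x) y)) \<le> \<eta> * M"
    using assms(12) \<eta> by (intro mult_left_mono) auto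
  ultimately have "(\<Sum>k\<in>UNIV. z $ k * expected_loss L (D k) (dist_weighted D h z \<eta>)) \<le> \<epsilon> + \<delta> / 2"
    using \<eta>M by linarith
  then have source_le: "expected_loss L (D k) (dist_weighted D h z \<eta>) \<le> \<epsilon> + \<delta>" for k
    using bal[of k] by linarith
  have "expected_loss L (mixture D v) (dist_weighted D h z \<eta>) \<le> \<epsilon> + \<delta>"
    if v: "v \<in> prob_simplex" for v
  proof -
    have "finite (set_pmf (D k))" for k
      using dist by (simp add: fin_dist_on_def)
    then show ?thesis
      using average_le[OF v source_le] by (simp add: expected_loss_mixture[OF _ v])
  qed
  then show ?thesis
    using \<eta> z by blast
qed

end
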